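(* Let $m\ge 1$, let $f_1,\dots,f_m:\mathbb{R}^d\to\mathbb{R}$ be twice continuously differentiable, and let $F(x)=\frac1m\sum_{k=1}^m f_k(x)$. Assume $F$ is convex, has a minimizer $x_F^*$, and has $L$-Lipschitz Hessian: $\|\nabla^2F(x)-\nabla^2F(y)\|\le L\|x-y\|$ for all $x,y$. Assume the statistical similarity condition: for some $\beta>0$ and every $k=1,\dots,m$, $\|\nabla^2F(x)-\nabla^2 f_k(x)\|\le\beta$ for all $x\in\mathbb{R}^d$. Let $\{x_t\}_{t\ge1}$ be generated by the Accelerated Cubic Newton method (Algorithm 1, described in the context) started from $x_0\in\mathbb{R}^d$. Then for every $t\ge1$, $$F(x_t)-F(x_F^* )\le \frac{98L\|x_0-x_F^*\|^3}{t^3}+\frac{48\beta\|x_0-x_F^*\|^2}{t^2}.$$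
   Context: Norms are Euclidean (operator norm for matrices). For $M>0$ and $x,z\in\mathbb{R}^d$ define the model $$\widetilde F_M(x,z)=F(z)+\langle\nabla F(z),x-z\rangle+\tfrac12\langle(\nabla^2 f_1(z)+3\beta I)(x-z),x-z\rangle+\tfrac M6\|x-z\|^3.$$ Algorithm 1 (Accelerated Cubic Newton), input $x_0$, $A_0=1$, $L$, $\beta$: Step 0: $x_1=\arg\min_x \widetilde F_{4L}(x,x_0)$; $\psi_1(x):=F(x_1)+8\beta\|x-x_0\|^2+16L\|x-x_0\|^3$; $y_1=\arg\min_x\psi_1(x)$; set $w_0=x_0$, $t=1$. Step 1: $w_t=\left(1-\frac{3}{t+3}\right)x_t+\frac{3}{t+3}y_t$, and $x_{t+1}=\arg\min_x\widetilde F_{4L}(x,w_t)$. Step 2: $A_t=A_{t-1}\left(1-\frac{3}{t+3}\right)$, $$\psi_{t+1}(x)=\psi_t(x)+4\beta\|x-x_0\|^2+\frac{3}{A_t(t+3)}\Big(F(x_{t+1})+\langle\nabla F(x_{t+1}),x-x_{t+1}\rangle\Big),$$ and $y_{t+1}=\arg\min_x\psi_{t+1}(x)$. Step 3: $t\leftarrow t+1$, go to Step 1. (In the distributed interpretation, $f_1$ is held by a master node and each iteration uses two communication rounds to aggregate gradients $\nabla F$.) *)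

theory Defs
  imports "HOL-Analysis.Analysis"
begin

definition avgF :: "nat \<Rightarrow> (nat \<Rightarrow> 'a \<Rightarrow> real) \<Rightarrow> 'a \<Rightarrow> real" where
  "avgF m f x = (1 / real m) * (\<Sum>k\<in>{1..m}. f k x)"

definition avgG :: "nat \<Rightarrow> (nat \<Rightarrow> 'a \<Rightarrow> 'a::real_vector) \<Rightarrow> 'a \<Rightarrow> 'a" where
  "avgG m g x = (1 / real m) *\<^sub>R (\<Sum>k\<in>{1..m}. g k x)"

definition avgH :: "nat \<Rightarrow> (nat \<Rightarrow> 'a \<Rightarrow> ('a::real_normed_vector \<Rightarrow>\<^sub>L 'a)) \<Rightarrow> 'a \<Rightarrow> ('a \<Rightarrow>\<^sub>L 'a)" where
  "avgH m H x = (1 / real m) *\<^sub>R (\<Sum>k\<in>{1..m}. H k x)"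

text \<open>The cubic model  F~_M(x,z) = F z + <gF z, x-z> + 1/2 <(H1 z + 3 beta I)(x-z), x-z>
  + M/6 |x-z|^3, where H1 is the Hessian of f_1.\<close>

definition cubic_model ::
  "('a::real_inner \<Rightarrow> real) \<Rightarrow> ('a \<Rightarrow> 'a) \<Rightarrow> ('a \<Rightarrow> ('a \<Rightarrow>\<^sub>L 'a)) \<Rightarrow> real \<Rightarrow> real \<Rightarrow> 'a \<Rightarrow> 'a \<Rightarrow> real" where
  "cubic_model F gF H1 \<beta> M x z =
     F z + gF z \<bullet> (x - z)
     + (1/2) * ((blinfun_apply (H1 z) (x - z) + (3 * \<beta>) *\<^sub>R (x - z)) \<bullet> (x - z))
     + (M / 6) * norm (x - z) ^ 3"

fun acn_A :: "nat \<Rightarrow> real" where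
  "acn_A 0 = 1"
| "acn_A (Suc t) = acn_A t * (1 - 3 / (real (Suc t) + 3))"

text \<open>Estimating functions psi_t (t >= 1); x is the iterate sequence with x 0 = x_0.
  The value at index 0 is an unused dummy.\<close>

fun acn_psi ::
  "('a::real_inner \<Rightarrow> real) \<Rightarrow> ('a \<Rightarrow> 'a) \<Rightarrow> real \<Rightarrow> real \<Rightarrow> (nat \<Rightarrow> 'a) \<Rightarrow> nat \<Rightarrow> 'a \<Rightarrow> real" where
  "acn_psi F gF L \<beta> x 0 u = 0"
| "acn_psi F gF L \<beta> x (Suc 0) u =
     F (x 1) + 8 * \<beta> * norm (u - x 0) ^ 2 + 16 * L * norm (u - x 0) ^ 3"
| "acn_psi F gF L \<beta> x (Suc (Suc t)) u =
     acn_psi F gF L \<beta> x (Suc t) u + 4 * \<beta> * norm (u - x 0) ^ 2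
     + 3 / (acn_A (Suc t) * (real (Suc t) + 3))
       * (F (x (Suc (Suc t))) + gF (x (Suc (Suc t))) \<bullet> (u - x (Suc (Suc t))))"

end

theory Submission
  imports Defs
begin

text \<open>
  The estimating functions satisfy \<open>F (x t) / A \<le> min \<psi>\<close> with \<open>A = 6 / (t (t+1) (t+2))\<close>: since
  \<open>\<psi>\<close> is affine plus \<open>b |u - x\<^sub>0|\<^sup>2 + 16 L |u - x\<^sub>0|\<^sup>3\<close>, it grows at least like
  \<open>b |u - y|\<^sup>2 + 8 L |u - y|\<^sup>3\<close> around its minimizer \<open>y\<close>, and this growth absorbs the linear term
  contributed by the new gradient, because a cubic Newton step \<open>h\<close> of length \<open>d\<close> leaves a gradient
  within \<open>(\<beta> + L d / 2) d\<close> of \<open>- (3 \<beta> + 2 L d) h\<close>.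

  Convexity bounds \<open>\<psi>\<close> at the minimizer of \<open>F\<close> from above by \<open>F\<^sup>* / A\<close> plus the regularization terms plus
  the gap \<open>F x\<^sub>1 - F\<^sup>*\<close>. Comparing model values at \<open>x\<^sub>1\<close> and at the minimizer bounds this gap only by
  \<open>5/6 L r\<^sup>3 + 2 \<beta> r\<^sup>2\<close>, which gives the constant 101 in place of 98. The vanishing of the gradient at
  the minimizer together with the trapezoid rule gives \<open>L r\<^sup>3 / 3 + \<beta> r\<^sup>2\<close>, and 98 = 6 (16 + 1/3).
\<close>

section \<open>Calculus along segments and the gradient inequality\<close>

text \<open>Mean value inequality against the primitive of \<open>c * s ^ n\<close>. The cases n =
  0, 1, 2 produce the remainder constants below.\<close>

lemma norm_increment_le_of_derivative_le_power:
  fixes f :: "real \<Rightarrow> 'b::real_normed_vector"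
  assumes f': "\<And>s. (f has_vector_derivative f' s) (at s)"
    and bound: "\<And>s. 0 < s \<Longrightarrow> s < 1 \<Longrightarrow> norm (f' s) \<le> c * s ^ n"
  shows "norm (f 1 - f 0) \<le> c / real (Suc n)"
proof -
  let ?p = "\<lambda>s::real. c / real (Suc n) * s ^ Suc n"
  have p': "(?p has_vector_derivative c * s ^ n) (at s)" for s
    unfolding has_real_derivative_iff_has_vector_derivative [symmetric]
    by (rule derivative_eq_intros refl)+ (simp del: of_nat_Suc)
  have "norm (f 1 - f 0) \<le> ?p 1 - ?p 0"
  proof (rule differentiable_bound_general)
    show "continuous_on {0..1} f"
      using f' has_vector_derivative_continuous continuous_at_imp_continuous_on by blast
    show "continuous_on {0..1} ?p"
      by (intro continuous_intros) auto
  qed (use f' p' bound in auto)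
  then show ?thesis by simp
qed

lemma convex_on_gradient_inequality:
  fixes F :: "'a::real_inner \<Rightarrow> real"
  assumes convex: "convex_on UNIV F"
    and deriv: "(F has_derivative (\<lambda>v. G \<bullet> v)) (at u)"
  shows "F u + G \<bullet> (v - u) \<le> F v"
proof -
  let ?p = "\<lambda>s::real. F (u + s *\<^sub>R (v - u))"
  have "convex_on UNIV ?p"
  proof (rule convex_onI)
    fix t a b :: real assume t: "0 < t" "t < 1"
    have "u + ((1 - t) *\<^sub>R a + t *\<^sub>R b) *\<^sub>R (v - u)
        = (1 - t) *\<^sub>R (u + a *\<^sub>R (v - u)) + t *\<^sub>R (u + b *\<^sub>R (v - u))"
      by (simp add: algebra_simps)
    then show "?p ((1 - t) *\<^sub>R a + t *\<^sub>R b) \<le> (1 - t) * ?p a + t * ?p b"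
      using convex_onD [OF convex, of t "u + a *\<^sub>R (v - u)" "u + b *\<^sub>R (v - u)"] t by simp
  qed simp
  moreover have "(?p has_field_derivative G \<bullet> (v - u)) (at 0)"
  proof -
    have "(F has_derivative (\<lambda>v. G \<bullet> v)) (at (u + 0 *\<^sub>R (v - u)))"
      using deriv by simp
    then have "(?p has_derivative (\<lambda>s. G \<bullet> (s *\<^sub>R (v - u)))) (at 0)"
      by (rule has_derivative_compose [rotated]) (auto intro!: derivative_eq_intros)
    then show ?thesis
      by (simp add: has_field_derivative_def mult_commute_abs)
  qed
  ultimately have "?p 1 - ?p 0 \<ge> (G \<bullet> (v - u)) * (1 - 0)"
    by (intro convex_on_imp_above_tangent [of UNIV]) auto
  then show ?thesis by simp
qed

section \<open>The cube of the norm and growth around a minimizer\<close>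

lemma has_derivative_norm_cube:
  fixes v :: "'a::real_inner"
  shows "((\<lambda>v. norm v ^ 3) has_derivative (\<lambda>k. 3 * norm v * (v \<bullet> k))) (at v)"
proof (cases "v = 0")
  case True
  have "((\<lambda>v::'a. norm v ^ 3) has_derivative (\<lambda>k. 0)) (at 0)"
  \<comment> \<open>The norm itself is not differentiable at 0; the difference quotient of its cube
    there is \<open>norm y ^ 2\<close>.\<close>
  proof (rule has_derivativeI_sandwich [where e = 1 and H = "\<lambda>y. norm y ^ 2"])
    have "((\<lambda>y::'a. norm y ^ 2) \<longlongrightarrow> norm (0::'a) ^ 2) (at 0)"
      by (intro tendsto_intros)
    then show "((\<lambda>y::'a. norm y ^ 2) \<longlongrightarrow> 0) (at 0)" by simp
  qed (auto simp: power3_eq_cube power2_eq_square)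
  with True show ?thesis by simp
next
  case False
  show ?thesis
    by (rule has_derivative_eq_rhs, rule has_derivative_power, rule has_derivative_norm [OF False])
      (use False in \<open>auto simp: sgn_div_norm power2_eq_square inner_commute field_simps\<close>)
qed

text \<open>By the law of cosines only the lengths a, b, D of v, u, u - v matter, and the claim
  becomes \<open>0 <= (b - a)^2 * (b + a/2) + D^2 * (3*a - D) / 2\<close>, which is delicate only if
  D > 3a.\<close>

lemma norm_cube_uniformly_convex:
  fixes u v :: "'a::real_inner"
  shows "norm v ^ 3 + 3 * norm v * (v \<bullet> (u - v)) + norm (u - v) ^ 3 / 2 \<le> norm u ^ 3"
proof -
  define a b D where "a = norm v" and "b = norm u" and "D = norm (u - v)"
  have nonneg: "0 \<le> a" "0 \<le> b" "0 \<le> D"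
    by (auto simp: a_def b_def D_def)
  have tri: "D \<le> a + b"
    unfolding a_def b_def D_def by (metis add.commute norm_triangle_ineq4)
  have "D\<^sup>2 = a\<^sup>2 + b\<^sup>2 - 2 * (v \<bullet> u)"
    unfolding a_def b_def D_def power2_norm_eq_inner
    by (simp add: inner_diff_left inner_diff_right inner_commute)
  moreover have "v \<bullet> (u - v) = v \<bullet> u - a\<^sup>2"
    by (simp add: a_def power2_norm_eq_inner inner_diff_right)
  ultimately have ip: "v \<bullet> (u - v) = (b\<^sup>2 - a\<^sup>2 - D\<^sup>2) / 2"
    by (simp add: field_simps)
  have "0 \<le> (b - a)\<^sup>2 * (b + a / 2) + D\<^sup>2 * (3 * a - D) / 2"
  proof (cases "D \<le> 3 * a")
    case True
    then show ?thesis using nonneg by auto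
  next
    case False
    \<comment> \<open>Since b >= D - a, the first term is at least its value at the collinear case b
      = D - a, where the whole expression is a sum of two nonnegative cubes.\<close>
    have "(D - 2 * a)\<^sup>2 * (D - a / 2) \<le> (b - a)\<^sup>2 * (b + a / 2)"
      using False tri nonneg by (intro mult_mono power_mono) auto
    moreover have "((D - 2 * a) ^ 3 + 4 * a ^ 3) / 2
        = (D - 2 * a)\<^sup>2 * (D - a / 2) + D\<^sup>2 * (3 * a - D) / 2"
      by (simp add: field_simps power2_eq_square power3_eq_cube)
    moreover have "0 \<le> ((D - 2 * a) ^ 3 + 4 * a ^ 3) / 2"
      using False nonneg by simp
    ultimately show ?thesis by (smt (verit))
  qed
  also have "\<dots> = b ^ 3 - (a ^ 3 + 3 * a * (v \<bullet> (u - v)) + D ^ 3 / 2)"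
    unfolding ip by (simp add: field_simps power2_eq_square power3_eq_cube)
  finally show ?thesis
    by (simp add: a_def b_def D_def)
qed

text \<open>Stationarity at \<open>y\<close> cancels the first-order terms. The square then expands
  exactly, while uniform convexity of the cube retains half of its coefficient.\<close>

lemma minimizer_growth_quadratic_cubic:
  fixes \<phi> :: "'a::real_inner \<Rightarrow> real"
  assumes \<phi>: "\<And>u. \<phi> u = c + s \<bullet> u + b * norm (u - z) ^ 2 + k * norm (u - z) ^ 3"
    and k: "0 \<le> k"
    and min: "\<And>u. \<phi> y \<le> \<phi> u"
  shows "\<phi> y + b * norm (u - y) ^ 2 + k / 2 * norm (u - y) ^ 3 \<le> \<phi> u"
proof -
  let ?D = "\<lambda>h. s \<bullet> h + b * (2 * ((y - z) \<bullet> h)) + k * (3 * norm (y - z) * ((y - z) \<bullet> h))"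
  have cube: "((\<lambda>u. norm (u - z) ^ 3) has_derivative (\<lambda>h. 3 * norm (y - z) * ((y - z) \<bullet> h))) (at y)"
    by (rule has_derivative_compose [OF _ has_derivative_norm_cube, of "\<lambda>u. u - z" "\<lambda>h. h"])
      (auto intro!: derivative_eq_intros)
  have "(\<phi> has_derivative ?D) (at y)"
    unfolding \<phi> [abs_def] power2_norm_eq_inner
    by (rule derivative_eq_intros cube refl)+ (auto simp: inner_commute)
  then have "?D = (\<lambda>h. 0)"
    by (rule has_derivative_local_min) (simp add: min)
  then have D: "?D (u - y) = 0" by meson
  have sq: "norm (u - z) ^ 2 = norm (y - z) ^ 2 + 2 * ((y - z) \<bullet> (u - y)) + norm (u - y) ^ 2"
    unfolding power2_norm_eq_inner by (simp add: algebra_simps inner_commute)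
  have "norm (y - z) ^ 3 + 3 * norm (y - z) * ((y - z) \<bullet> (u - y)) + norm (u - y) ^ 3 / 2
      \<le> norm (u - z) ^ 3"
    using norm_cube_uniformly_convex [of "y - z" "u - z"] by simp
  from mult_left_mono [OF this k] D show ?thesis
    unfolding \<phi> sq by (simp add: algebra_simps)
qed

section \<open>Remainder estimates under a Lipschitz Hessian\<close>

locale lipschitz_hessian =
  fixes F :: "'a::real_inner \<Rightarrow> real" and G :: "'a \<Rightarrow> 'a" and H :: "'a \<Rightarrow> 'a \<Rightarrow>\<^sub>L 'a" and L :: real
  assumes F_deriv: "\<And>z. (F has_derivative (\<lambda>v. G z \<bullet> v)) (at z)"
    and G_deriv: "\<And>z. (G has_derivative blinfun_apply (H z)) (at z)"
    and H_lipschitz: "\<And>u v. norm (H u - H v) \<le> L * norm (u - v)"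
    and L_pos: "0 < L"
begin

lemma F_line_deriv: "((\<lambda>s. F (z + s *\<^sub>R h)) has_real_derivative G (z + s *\<^sub>R h) \<bullet> h) (at s)"
proof -
  have "((\<lambda>s. F (z + s *\<^sub>R h)) has_derivative (\<lambda>r. G (z + s *\<^sub>R h) \<bullet> (r *\<^sub>R h))) (at s)"
    by (rule has_derivative_compose [OF _ F_deriv]) (auto intro!: derivative_eq_intros)
  then show ?thesis
    by (simp add: has_field_derivative_def mult_commute_abs)
qed

lemma G_line_deriv:
  "((\<lambda>s. G (z + s *\<^sub>R h)) has_vector_derivative H (z + s *\<^sub>R h) h) (at s)"
proof -
  have "((\<lambda>s. G (z + s *\<^sub>R h)) has_derivative (\<lambda>r. H (z + s *\<^sub>R h) (r *\<^sub>R h))) (at s)"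
    by (rule has_derivative_compose [OF _ G_deriv]) (auto intro!: derivative_eq_intros)
  then show ?thesis
    by (simp add: has_vector_derivative_def blinfun.scaleR_right)
qed

lemma gradient_remainder: "norm (G (z + h) - G z - H z h) \<le> L / 2 * norm h ^ 2"
proof -
  let ?f = "\<lambda>s::real. G (z + s *\<^sub>R h) - s *\<^sub>R H z h"
  have "norm (?f 1 - ?f 0) \<le> (L * norm h ^ 2) / real (Suc 1)"
  proof (rule norm_increment_le_of_derivative_le_power)
    show "(?f has_vector_derivative H (z + s *\<^sub>R h) h - H z h) (at s)" for s
      by (rule derivative_eq_intros G_line_deriv refl)+ simp
    show "norm (H (z + s *\<^sub>R h) h - H z h) \<le> L * norm h ^ 2 * s ^ 1" if "0 < s" for s :: real
    proof -
      have "norm ((H (z + s *\<^sub>R h) - H z) h) \<le> norm (H (z + s *\<^sub>R h) - H z) * norm h"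
        by (rule norm_blinfun)
      also have "\<dots> \<le> (L * norm (s *\<^sub>R h)) * norm h"
        using H_lipschitz [of "z + s *\<^sub>R h" z] by (intro mult_right_mono) auto
      finally show ?thesis
        using that by (simp add: blinfun.diff_left power2_eq_square mult_ac)
    qed
  qed
  then show ?thesis by (simp add: algebra_simps)
qed

text \<open>Prepares the symmetry of the Hessian: the second difference is symmetric in
  \<open>u\<close> and \<open>v\<close>, so it can be compared with the Hessian form in either
  order.\<close>

lemma second_difference_remainder:
  "\<bar>F (z + u + v) - F (z + u) - F (z + v) + F z - H z v \<bullet> u\<bar> \<le> L * (norm u + norm v) ^ 3"
proof -
  define K where "K = norm u + norm v"
  let ?f = "\<lambda>s::real. F ((z + v) + s *\<^sub>R u) - F (z + s *\<^sub>R u) - s * (H z v \<bullet> u)"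
  let ?f' = "\<lambda>s::real. G ((z + v) + s *\<^sub>R u) \<bullet> u - G (z + s *\<^sub>R u) \<bullet> u - H z v \<bullet> u"
  have "norm (?f 1 - ?f 0) \<le> (L * K ^ 3) / real (Suc 0)"
  proof (rule norm_increment_le_of_derivative_le_power)
    show "(?f has_vector_derivative ?f' s) (at s)" for s
      unfolding has_real_derivative_iff_has_vector_derivative [symmetric]
      by (rule derivative_eq_intros F_line_deriv refl)+ simp
    show "norm (?f' s) \<le> L * K ^ 3 * s ^ 0" if s: "0 < s" "s < 1" for s :: real
    proof -
      have su: "norm (s *\<^sub>R u) \<le> norm u"
        using s by (simp add: mult_left_le_one_le)
      have sq: "L / 2 * norm h ^ 2 \<le> L / 2 * K ^ 2" if "norm h \<le> K" for h :: 'a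
        using that L_pos by (intro mult_left_mono power_mono) auto
      have "norm (v + s *\<^sub>R u) \<le> K" "norm (s *\<^sub>R u) \<le> K"
        unfolding K_def using su norm_triangle_ineq [of v "s *\<^sub>R u"] norm_ge_zero [of v]
        by linarith+
      then have "norm (G (z + (v + s *\<^sub>R u)) - G z - H z (v + s *\<^sub>R u)) \<le> L / 2 * K ^ 2"
          "norm (G (z + s *\<^sub>R u) - G z - H z (s *\<^sub>R u)) \<le> L / 2 * K ^ 2"
        using gradient_remainder sq by (meson order_trans)+
      \<comment> \<open>Both gradients are expanded at the same point \<open>z\<close>, so the
        contributions of \<open>s u\<close> to the linear terms cancel and only \<open>H z v\<close>
        remains.\<close>
      from norm_triangle_le_diff [OF add_mono [OF this]]
      have "norm (G ((z + v) + s *\<^sub>R u) - G (z + s *\<^sub>R u) - H z v) \<le> L * K ^ 2"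
        by (simp add: blinfun.add_right algebra_simps)
      then have "norm (G ((z + v) + s *\<^sub>R u) - G (z + s *\<^sub>R u) - H z v) * norm u \<le> L * K ^ 2 * K"
        using L_pos by (intro mult_mono) (auto simp: K_def)
      moreover have "norm (?f' s)
          \<le> norm (G ((z + v) + s *\<^sub>R u) - G (z + s *\<^sub>R u) - H z v) * norm u"
        using Cauchy_Schwarz_ineq2 [of "G ((z + v) + s *\<^sub>R u) - G (z + s *\<^sub>R u) - H z v" u]
        by (simp add: inner_diff_left)
      ultimately show ?thesis
        by (simp add: power3_eq_cube power2_eq_square mult_ac)
    qed
  qed
  then show ?thesis
    by (simp add: K_def algebra_simps)
qed

text \<open>Both orders approximate one second difference. Scaling \<open>u\<close> and
  \<open>v\<close> by s makes the discrepancy s^2 e and the error of order s^3, so e = 0 as s tends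
  to 0.\<close>

lemma hessian_symmetric: "H z v \<bullet> u = H z u \<bullet> v"
proof -
  define e where "e = \<bar>H z v \<bullet> u - H z u \<bullet> v\<bar>"
  define K where "K = norm u + norm v"
  define C where "C = 2 * L * K ^ 3"
  have C: "0 \<le> C" using L_pos by (auto simp: C_def K_def)
  have le: "e \<le> C * s" if s: "0 < s" for s :: real
  proof -
    let ?u = "s *\<^sub>R u" and ?v = "s *\<^sub>R v"
    have "\<bar>H z ?v \<bullet> ?u - H z ?u \<bullet> ?v\<bar> \<le> 2 * (L * (norm ?u + norm ?v) ^ 3)"
      using second_difference_remainder [of z ?u ?v] second_difference_remainder [of z ?v ?u]
      by (simp add: algebra_simps)
    moreover have "\<bar>H z ?v \<bullet> ?u - H z ?u \<bullet> ?v\<bar> = s\<^sup>2 * e"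
    proof -
      have "H z ?v \<bullet> ?u - H z ?u \<bullet> ?v = s\<^sup>2 * (H z v \<bullet> u - H z u \<bullet> v)"
        by (simp add: blinfun.scaleR_right power2_eq_square algebra_simps)
      then show ?thesis by (simp add: abs_mult e_def)
    qed
    moreover have "norm ?u + norm ?v = s * K"
      using s by (simp add: K_def algebra_simps)
    ultimately have "s\<^sup>2 * e \<le> 2 * (L * (s * K) ^ 3)" by metis
    also have "\<dots> = s\<^sup>2 * (C * s)"
      by (simp add: C_def power3_eq_cube power2_eq_square)
    finally have "s\<^sup>2 * e \<le> s\<^sup>2 * (C * s)" .
    then show ?thesis using s by simp
  qed
  have "e \<le> 0"
  proof (rule field_le_epsilon)
    fix \<epsilon> :: real assume "0 < \<epsilon>"
    then have "e \<le> C * (\<epsilon> / (C + 1))"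
      using C by (intro le) auto
    also have "\<dots> \<le> \<epsilon>"
      using C \<open>0 < \<epsilon>\<close> by (simp add: field_simps)
    finally show "e \<le> 0 + \<epsilon>" by simp
  qed
  then show ?thesis by (simp add: e_def)
qed

text \<open>The error of the rule on [0, s] is differentiated in s. Its derivative is half a
  gradient remainder, at most L/4 |q|^3 s^2, and integration gives the constant 1/12.\<close>

lemma trapezoid_rule:
  "\<bar>F (z + q) - F z - (G z \<bullet> q + G (z + q) \<bullet> q) / 2\<bar> \<le> L / 12 * norm q ^ 3"
proof -
  let ?f = "\<lambda>s::real. F (z + s *\<^sub>R q) - s * (G z \<bullet> q + G (z + s *\<^sub>R q) \<bullet> q) / 2"
  let ?f' = "\<lambda>s::real. (G (z + s *\<^sub>R q) \<bullet> q - G z \<bullet> q - s * (H (z + s *\<^sub>R q) q \<bullet> q)) / 2"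
  have "norm (?f 1 - ?f 0) \<le> (L / 4 * norm q ^ 3) / real (Suc 2)"
  proof (rule norm_increment_le_of_derivative_le_power)
    have G': "((\<lambda>s. G (z + s *\<^sub>R q) \<bullet> q) has_real_derivative H (z + s *\<^sub>R q) q \<bullet> q) (at s)" for s
      unfolding has_real_derivative_iff_has_vector_derivative
      using bounded_linear.has_vector_derivative [OF bounded_linear_inner_left G_line_deriv] .
    show "(?f has_vector_derivative ?f' s) (at s)" for s
      unfolding has_real_derivative_iff_has_vector_derivative [symmetric]
      by (auto intro!: derivative_eq_intros F_line_deriv G' simp: field_simps)
    show "norm (?f' s) \<le> L / 4 * norm q ^ 3 * s ^ 2" for s :: real
    proof -
      let ?z = "z + s *\<^sub>R q"
      \<comment> \<open>The expansion runs backwards from the moving endpoint, because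
        \<open>?f'\<close> contains the Hessian at that endpoint.\<close>
      have "norm (G (?z + - (s *\<^sub>R q)) - G ?z - H ?z (- (s *\<^sub>R q))) \<le> L / 2 * norm (- (s *\<^sub>R q)) ^ 2"
        by (rule gradient_remainder)
      then have "norm (G z - G ?z + s *\<^sub>R H ?z q) \<le> L / 2 * (s\<^sup>2 * norm q ^ 2)"
        by (simp add: blinfun.minus_right blinfun.scaleR_right power_mult_distrib)
      then have "norm (G z - G ?z + s *\<^sub>R H ?z q) * norm q \<le> L / 2 * (s\<^sup>2 * norm q ^ 2) * norm q"
        by (intro mult_right_mono) auto
      moreover have "\<bar>(G z - G ?z + s *\<^sub>R H ?z q) \<bullet> q\<bar> \<le> norm (G z - G ?z + s *\<^sub>R H ?z q) * norm q"
        by (rule Cauchy_Schwarz_ineq2)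
      moreover have "\<bar>(G z - G ?z + s *\<^sub>R H ?z q) \<bullet> q\<bar> = 2 * norm (?f' s)"
        by (simp add: inner_add_left inner_diff_left)
      ultimately show ?thesis
        by (simp add: power3_eq_cube power2_eq_square mult_ac)
    qed
  qed
  then show ?thesis by (simp add: algebra_simps)
qed

end

section \<open>Inequalities for a single cubic step\<close>

lemma sq_mult_le_cubes:
  fixes a b :: real
  assumes "0 \<le> a" "0 \<le> b"
  shows "3 * (a * b\<^sup>2) \<le> a ^ 3 + 2 * b ^ 3"
proof -
  have "0 \<le> (a - b)\<^sup>2 * (a + 2 * b)" using assms by simp
  also have "\<dots> = a ^ 3 + 2 * b ^ 3 - 3 * (a * b\<^sup>2)"
    by (simp add: power2_eq_square power3_eq_cube algebra_simps)
  finally show ?thesis by simp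
qed

text \<open>With gamma = 3 beta + 2 L |h|, the hypothesis says that g equals - gamma h up to an
  error of at most gamma |h| / 3. Squaring bounds - g.h below by |g|^2 / (2 gamma) + 4/9 gamma
  |h|^2, and this pays for |g| rho. The constants 16/9 and 8/3 fit the growth available in
  \<open>acn_estimate\<close>.\<close>

lemma cubic_step_inequality:
  fixes g h :: "'a::real_inner" and L \<beta> \<rho> :: real
  assumes pos: "0 < L" "0 < \<beta>" "0 \<le> \<rho>"
    and step: "norm (g + (3 * \<beta> + 2 * L * norm h) *\<^sub>R h) \<le> (\<beta> + L / 2 * norm h) * norm h"
  shows "norm g * \<rho> \<le> - (g \<bullet> h) + 16 / 9 * L * \<rho> ^ 3 + 8 / 3 * \<beta> * \<rho>\<^sup>2"
proof -
  define d where "d = norm h"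
  define \<gamma> where "\<gamma> = 3 * \<beta> + 2 * L * d"
  have d: "0 \<le> d" by (simp add: d_def)
  have \<gamma>: "0 < \<gamma>" using pos d by (simp add: \<gamma>_def add_pos_nonneg)
  have "norm (g + \<gamma> *\<^sub>R h) \<le> (\<beta> + L / 2 * d) * d"
    using step by (simp add: \<gamma>_def d_def)
  also have "\<dots> \<le> \<gamma> / 3 * d"
    using pos d by (intro mult_right_mono) (auto simp: \<gamma>_def)
  finally have "norm (g + \<gamma> *\<^sub>R h) ^ 2 \<le> (\<gamma> / 3 * d)\<^sup>2"
    by (intro power_mono) auto
  moreover have "norm (g + \<gamma> *\<^sub>R h) ^ 2 = norm g ^ 2 + 2 * \<gamma> * (g \<bullet> h) + \<gamma>\<^sup>2 * d\<^sup>2"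
    unfolding power2_norm_eq_inner d_def
    by (simp add: inner_add_left inner_add_right inner_commute power2_eq_square)
  \<comment> \<open>Young's inequality trades |g| rho for |g|^2 / (2 gamma) + gamma rho^2 /
    2.\<close>
  moreover have "0 \<le> (norm g - \<gamma> * \<rho>)\<^sup>2" by simp
  ultimately have "\<gamma> * (2 * (norm g * \<rho> + g \<bullet> h)) \<le> \<gamma> * (\<gamma> * (\<rho>\<^sup>2 - 8 / 9 * d\<^sup>2))"
    by (simp add: power2_eq_square algebra_simps)
  then have "2 * (norm g * \<rho> + g \<bullet> h) \<le> \<gamma> * (\<rho>\<^sup>2 - 8 / 9 * d\<^sup>2)"
    using \<gamma> by simp
  also have "\<dots> = \<beta> * (3 * \<rho>\<^sup>2 - 8 / 3 * d\<^sup>2) + L * (2 * (d * \<rho>\<^sup>2) - 16 / 9 * d ^ 3)"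
    by (simp add: \<gamma>_def power2_eq_square power3_eq_cube algebra_simps)
  also have "\<dots> \<le> \<beta> * (16 / 3 * \<rho>\<^sup>2) + L * (32 / 9 * \<rho> ^ 3)"
  proof (intro add_mono mult_left_mono)
    \<comment> \<open>The negative cube of d absorbs the d^3 part of the mixed term d rho^2.\<close>
    have "0 \<le> d ^ 3" "0 \<le> \<rho> ^ 3" using d pos by auto
    then show "2 * (d * \<rho>\<^sup>2) - 16 / 9 * d ^ 3 \<le> 32 / 9 * \<rho> ^ 3"
      using sq_mult_le_cubes [OF d \<open>0 \<le> \<rho>\<close>] by linarith
    show "3 * \<rho>\<^sup>2 - 8 / 3 * d\<^sup>2 \<le> 16 / 3 * \<rho>\<^sup>2"
      using zero_le_power2 [of d] zero_le_power2 [of \<rho>] by linarith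
  qed (use pos in auto)
  finally show ?thesis by simp
qed

text \<open>Scalar core of the first-step estimate: d is the step length, r and \<sigma> are the
  distances of its start and end to the stationary point. The bound splits into 2/9 r^3 and 1/12
  r^3, whose sum 11/36 r^3 is below r^3 / 3.\<close>

lemma first_step_cubic_bound:
  fixes d r \<sigma> :: real
  assumes nonneg: "0 \<le> d" "0 \<le> r" "0 \<le> \<sigma>" and tri: "\<sigma> \<le> r + d"
  shows "d * (r\<^sup>2 - d\<^sup>2 - \<sigma>\<^sup>2) / 2 + d\<^sup>2 * \<sigma> / 4 + \<sigma> ^ 3 / 12 \<le> r ^ 3 / 3"
proof -
  have "\<sigma> ^ 3 \<le> (r + d) * \<sigma>\<^sup>2"
    using mult_right_mono [OF tri, of "\<sigma>\<^sup>2"] by (simp add: power2_eq_square power3_eq_cube mult_ac)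
  moreover have "2 * (d\<^sup>2 * \<sigma>) \<le> d ^ 3 + d * \<sigma>\<^sup>2"
  proof -
    have "0 \<le> d * (d - \<sigma>)\<^sup>2" using nonneg by simp
    then show ?thesis by (simp add: power2_eq_square power3_eq_cube algebra_simps)
  qed
  moreover have expand: "d * (r\<^sup>2 - d\<^sup>2 - \<sigma>\<^sup>2) / 2 = d * r\<^sup>2 / 2 - d ^ 3 / 2 - d * \<sigma>\<^sup>2 / 2"
    "(r + d) * \<sigma>\<^sup>2 = r * \<sigma>\<^sup>2 + d * \<sigma>\<^sup>2"
    "\<sigma>\<^sup>2 * (2 * r - 7 * d) / 24 = r * \<sigma>\<^sup>2 / 12 - 7 * (d * \<sigma>\<^sup>2) / 24"
    by (simp_all add: power2_eq_square power3_eq_cube field_simps)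
  ultimately have 1: "d * (r\<^sup>2 - d\<^sup>2 - \<sigma>\<^sup>2) / 2 + d\<^sup>2 * \<sigma> / 4 + \<sigma> ^ 3 / 12
      \<le> d * r\<^sup>2 / 2 - 3 / 8 * d ^ 3 + \<sigma>\<^sup>2 * (2 * r - 7 * d) / 24"
    unfolding expand by linarith
  \<comment> \<open>The left side is largest at d = 2r/3, which dictates the instance.\<close>
  have 2: "d * r\<^sup>2 / 2 - 3 / 8 * d ^ 3 \<le> 2 / 9 * r ^ 3"
    using sq_mult_le_cubes [of d "2 / 3 * r"] nonneg
    by (simp add: power2_eq_square power3_eq_cube)
  have 3: "\<sigma>\<^sup>2 * (2 * r - 7 * d) / 24 \<le> r ^ 3 / 12"
  proof (cases "7 * d \<le> 2 * r")
    case True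
    have "\<sigma>\<^sup>2 * (2 * r - 7 * d) \<le> (r + d)\<^sup>2 * (2 * r - 7 * d)"
      using True tri nonneg by (intro mult_right_mono power_mono) auto
    also have "\<dots> = 2 * r ^ 3 - (3 * r\<^sup>2 * d + 12 * r * d\<^sup>2 + 7 * d ^ 3)"
      by (simp add: power2_eq_square power3_eq_cube algebra_simps)
    also have "\<dots> \<le> 2 * r ^ 3"
    proof -
      have "0 \<le> 3 * r\<^sup>2 * d + 12 * r * d\<^sup>2 + 7 * d ^ 3" using nonneg by simp
      then show ?thesis by linarith
    qed
    finally show ?thesis by simp
  next
    case False
    then have "\<sigma>\<^sup>2 * (2 * r - 7 * d) \<le> 0"
      by (intro mult_nonneg_nonpos) auto
    moreover have "0 \<le> r ^ 3" using nonneg by simp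
    ultimately show ?thesis by linarith
  qed
  note 1
  also note add_mono [OF 2 3]
  also have "2 / 9 * r ^ 3 + r ^ 3 / 12 \<le> r ^ 3 / 3"
    using nonneg by simp
  finally show ?thesis .
qed

section \<open>Weights and shape of the estimating functions\<close>

text \<open>The factor 1 - 3/(t + 3) is t/(t + 3), so the product telescopes.\<close>

lemma acn_A_eq: "acn_A t = 6 / ((real t + 1) * (real t + 2) * (real t + 3))"
proof (induction t)
  case (Suc t)
  have "1 - 3 / (real (Suc t) + 3) = (real t + 1) / (real t + 4)"
    by (simp add: field_simps)
  with Suc show ?case
    by (simp add: divide_simps) (simp add: algebra_simps)
qed simp

lemma acn_A_pos: "0 < acn_A t"
  by (simp add: acn_A_eq)

text \<open>The weights of the linear terms are the increments of 1/A. Together with the weight 1 of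
  \<open>F (x 1)\<close> they therefore add up to 1/A.\<close>

lemma inverse_acn_A_Suc:
  "1 / acn_A t + 3 / (acn_A (Suc t) * (real (Suc t) + 3)) = 1 / acn_A (Suc t)"
proof -
  have "acn_A (Suc t) = acn_A t * (real t + 1) / (real t + 4)"
    by (simp add: field_simps)
  with acn_A_pos [of t] show ?thesis
    by (simp add: divide_simps)
qed

lemma acn_psi_form:
  "\<exists>c s. \<forall>u. acn_psi F G L \<beta> x (Suc t) u
     = c + s \<bullet> u + (8 + 4 * real t) * \<beta> * norm (u - x 0) ^ 2 + 16 * L * norm (u - x 0) ^ 3"
proof (induction t)
  case 0
  show ?case by (rule exI [of _ "F (x 1)"], rule exI [of _ 0]) simp
next
  case (Suc t)
  then obtain c s where IH: "\<And>u. acn_psi F G L \<beta> x (Suc t) u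
     = c + s \<bullet> u + (8 + 4 * real t) * \<beta> * norm (u - x 0) ^ 2 + 16 * L * norm (u - x 0) ^ 3"
    by blast
  define \<kappa> where "\<kappa> = 3 / (acn_A (Suc t) * (real (Suc t) + 3))"
  let ?X = "x (Suc (Suc t))"
  show ?case
    unfolding acn_psi.simps(3) IH \<kappa>_def [symmetric]
    by (rule exI [of _ "c + \<kappa> * (F ?X - G ?X \<bullet> ?X)"], rule exI [of _ "s + \<kappa> *\<^sub>R G ?X"])
      (simp add: algebra_simps)
qed

section \<open>Cubic Newton steps and the estimating sequence\<close>

context lipschitz_hessian
begin

text \<open>The first-order condition of the model differs from the residual R only by the Taylor
  error of \<open>G\<close> and the Hessian mismatch. The bound is tested against every direction k,
  and k = R gives the norm.\<close>

lemma cubic_model_minimizer_gradient: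
  fixes z p :: 'a
  assumes similar: "norm (H z - H\<^sub>1 z) \<le> \<beta>"
    and min: "\<And>u. cubic_model F G H\<^sub>1 \<beta> (4 * L) p z \<le> cubic_model F G H\<^sub>1 \<beta> (4 * L) u z"
  shows "norm (G p + (3 * \<beta> + 2 * L * norm (p - z)) *\<^sub>R (p - z))
    \<le> (\<beta> + L / 2 * norm (p - z)) * norm (p - z)"
proof -
  define h where "h = p - z"
  have p: "p = z + h" by (simp add: h_def)
  define R where "R = G p + (3 * \<beta> + 2 * L * norm h) *\<^sub>R h"
  let ?D = "\<lambda>k. G z \<bullet> k + (1/2) * ((H\<^sub>1 z k + (3 * \<beta>) *\<^sub>R k) \<bullet> h + (H\<^sub>1 z h + (3 * \<beta>) *\<^sub>R h) \<bullet> k)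
      + (4 * L / 6) * (3 * norm h * (h \<bullet> k))"
  have cube: "((\<lambda>u. norm (u - z) ^ 3) has_derivative (\<lambda>k. 3 * norm h * (h \<bullet> k))) (at p)"
    unfolding h_def
    by (rule has_derivative_compose [OF _ has_derivative_norm_cube, of "\<lambda>u. u - z" "\<lambda>h. h"])
      (auto intro!: derivative_eq_intros)
  have lin: "((\<lambda>u. blinfun_apply (H\<^sub>1 z) (u - z)) has_derivative blinfun_apply (H\<^sub>1 z)) (at p)"
    by (rule has_derivative_eq_rhs,
        rule bounded_linear.has_derivative [OF blinfun.bounded_linear_right [of "H\<^sub>1 z"]])
      (auto intro!: derivative_eq_intros)
  have "((\<lambda>u. cubic_model F G H\<^sub>1 \<beta> (4 * L) u z) has_derivative ?D) (at p)"
    unfolding cubic_model_def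
    by (rule derivative_eq_intros cube lin refl)+ (simp add: h_def algebra_simps inner_commute)
  then have "?D = (\<lambda>k. 0)"
    by (rule has_derivative_local_min) (simp add: min)
  then have stationary: "?D k = 0" for k by meson
  have bound: "R \<bullet> k \<le> (\<beta> + L / 2 * norm h) * norm h * norm k" for k
  proof -
    let ?E = "H z - H\<^sub>1 z"
    have "R \<bullet> k = R \<bullet> k - ?D k" using stationary by simp
    \<comment> \<open>By symmetry, \<open>H z h\<close> paired with k is the average of both orders,
      matching the symmetrized form in which the derivative of the model contains
      \<open>H\<^sub>1\<close>.\<close>
    also have "\<dots> = (G (z + h) - G z - H z h) \<bullet> k + (?E k \<bullet> h + ?E h \<bullet> k) / 2"
      using hessian_symmetric [of z k h]
      by (simp add: R_def p blinfun.diff_left inner_add_left inner_add_right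
          inner_diff_left inner_diff_right inner_commute field_simps)
    also have "\<dots> \<le> L / 2 * norm h ^ 2 * norm k + (\<beta> * norm k * norm h + \<beta> * norm h * norm k) / 2"
    proof -
      have E: "?E a \<bullet> b \<le> \<beta> * norm a * norm b" for a b
      proof -
        have "?E a \<bullet> b \<le> norm (?E a) * norm b" by (rule norm_cauchy_schwarz)
        also have "\<dots> \<le> (norm ?E * norm a) * norm b"
          by (intro mult_right_mono norm_blinfun) auto
        also have "\<dots> \<le> \<beta> * norm a * norm b"
          by (intro mult_right_mono similar) auto
        finally show ?thesis .
      qed
      have "(G (z + h) - G z - H z h) \<bullet> k \<le> norm (G (z + h) - G z - H z h) * norm k"
        by (rule norm_cauchy_schwarz)
      also have "\<dots> \<le> L / 2 * norm h ^ 2 * norm k"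
        by (intro mult_right_mono gradient_remainder) auto
      finally show ?thesis
        by (intro add_mono divide_right_mono E) auto
    qed
    finally show ?thesis
      by (simp add: power2_eq_square algebra_simps)
  qed
  show ?thesis
  proof (cases "R = 0")
    case True
    have "0 \<le> \<beta>" using similar norm_ge_zero order_trans by blast
    with True L_pos show ?thesis by (simp add: R_def h_def)
  next
    case False
    have "norm R * norm R \<le> (\<beta> + L / 2 * norm h) * norm h * norm R"
      using bound [of R] by (simp add: power2_norm_eq_inner [symmetric] power2_eq_square)
    then have "norm R \<le> (\<beta> + L / 2 * norm h) * norm h"
      using False by simp
    then show ?thesis by (simp add: R_def h_def)
  qed
qed

text \<open>As \<open>G u = 0\<close>, the trapezoid rule on [p, u] involves only
  \<open>G p\<close>, which is close to a negative multiple of the step, and it halves that linear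
  term.\<close>

lemma cubic_step_gap_from_stationary_point:
  fixes z p u :: 'a
  assumes \<beta>: "0 < \<beta>"
    and step: "norm (G p + (3 * \<beta> + 2 * L * norm (p - z)) *\<^sub>R (p - z))
      \<le> (\<beta> + L / 2 * norm (p - z)) * norm (p - z)"
    and crit: "G u = 0"
  shows "F p - F u \<le> \<beta> * norm (z - u) ^ 2 + L / 3 * norm (z - u) ^ 3"
proof -
  define h q where "h = p - z" and "q = u - p"
  define d \<sigma> r where "d = norm h" and "\<sigma> = norm q" and "r = norm (z - u)"
  have nonneg: "0 \<le> d" "0 \<le> \<sigma>" "0 \<le> r" by (auto simp: d_def \<sigma>_def r_def)
  have tri: "\<sigma> \<le> r + d"
    using norm_triangle_ineq [of "u - z" "z - p"]
    by (simp add: \<sigma>_def r_def d_def q_def h_def norm_minus_commute)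
  have r2: "r\<^sup>2 = d\<^sup>2 + \<sigma>\<^sup>2 + 2 * (h \<bullet> q)"
    unfolding r_def d_def \<sigma>_def power2_norm_eq_inner h_def q_def
    by (simp add: algebra_simps inner_commute)
  have "\<bar>F u - F p - G p \<bullet> q / 2\<bar> \<le> L / 12 * \<sigma> ^ 3"
    using trapezoid_rule [of p q] crit by (simp add: q_def \<sigma>_def)
  then have gap: "F p - F u \<le> - (G p \<bullet> q) / 2 + L / 12 * \<sigma> ^ 3" by linarith
  have "- (G p \<bullet> q) = (3 * \<beta> + 2 * L * d) * (h \<bullet> q) - (G p + (3 * \<beta> + 2 * L * d) *\<^sub>R h) \<bullet> q"
    by (simp add: inner_add_left)
  also have "\<dots> \<le> (3 * \<beta> + 2 * L * d) * (h \<bullet> q) + (\<beta> + L / 2 * d) * d * \<sigma>"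
  proof -
    have "\<bar>(G p + (3 * \<beta> + 2 * L * d) *\<^sub>R h) \<bullet> q\<bar> \<le> norm (G p + (3 * \<beta> + 2 * L * d) *\<^sub>R h) * \<sigma>"
      unfolding \<sigma>_def by (rule Cauchy_Schwarz_ineq2)
    also have "\<dots> \<le> (\<beta> + L / 2 * d) * d * \<sigma>"
      using step nonneg by (intro mult_right_mono) (auto simp: h_def d_def)
    finally show ?thesis by linarith
  qed
  also have "\<dots> = \<beta> * (3 * (h \<bullet> q) + d * \<sigma>) + L * (2 * d * (h \<bullet> q) + d\<^sup>2 * \<sigma> / 2)"
    by (simp add: power2_eq_square algebra_simps)
  also have "\<dots> \<le> \<beta> * (2 * r\<^sup>2) + L * (2 * d * (h \<bullet> q) + d\<^sup>2 * \<sigma> / 2)"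
  proof -
    have "h \<bullet> q = h \<bullet> (u - z) - d\<^sup>2"
      by (simp add: d_def power2_norm_eq_inner h_def q_def algebra_simps inner_commute)
    moreover have "h \<bullet> (u - z) \<le> d * r"
      unfolding d_def r_def norm_minus_commute [of z u] by (rule norm_cauchy_schwarz)
    moreover have "d * \<sigma> \<le> d * r + d\<^sup>2"
      using mult_left_mono [OF tri nonneg(1)] by (simp add: power2_eq_square algebra_simps)
    moreover have "0 \<le> 2 * (d - r)\<^sup>2" by simp
    then have "4 * (d * r) - 2 * d\<^sup>2 \<le> 2 * r\<^sup>2"
      by (simp add: power2_eq_square algebra_simps)
    ultimately have "3 * (h \<bullet> q) + d * \<sigma> \<le> 2 * r\<^sup>2" by linarith
    then show ?thesis using \<beta> by simp
  qed
  finally have "F p - F u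
      \<le> \<beta> * r\<^sup>2 + L * (d * (2 * (h \<bullet> q)) / 2 + d\<^sup>2 * \<sigma> / 4 + \<sigma> ^ 3 / 12)"
    using gap by (simp add: algebra_simps)
  also have "\<dots> \<le> \<beta> * r\<^sup>2 + L * (r ^ 3 / 3)"
  proof -
    have "2 * (h \<bullet> q) = r\<^sup>2 - d\<^sup>2 - \<sigma>\<^sup>2" using r2 by simp
    then show ?thesis
      using first_step_cubic_bound [OF nonneg(1,3,2) tri] L_pos by simp
  qed
  finally show ?thesis by (simp add: r_def)
qed

text \<open>Each linear term lies below \<open>F\<close>. The gap \<open>F (x 1) - F u\<close>
  appears because the first estimating function contains the value \<open>F (x 1)\<close> instead of
  a lower model.\<close>

lemma acn_psi_upper_bound:
  assumes convex: "convex_on UNIV F"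
  shows "acn_psi F G L \<beta> x (Suc t) u \<le> F u / acn_A t + (F (x 1) - F u)
    + (8 + 4 * real t) * \<beta> * norm (u - x 0) ^ 2 + 16 * L * norm (u - x 0) ^ 3"
proof (induction t)
  case (Suc t)
  define \<kappa> where "\<kappa> = 3 / (acn_A (Suc t) * (real (Suc t) + 3))"
  let ?X = "x (Suc (Suc t))"
  have "0 \<le> \<kappa>" using acn_A_pos [of "Suc t"] by (simp add: \<kappa>_def)
  then have "\<kappa> * (F ?X + G ?X \<bullet> (u - ?X)) \<le> \<kappa> * F u"
    by (intro mult_left_mono convex_on_gradient_inequality [OF convex F_deriv])
  moreover have "F u / acn_A t + \<kappa> * F u = F u / acn_A (Suc t)"
    using arg_cong [OF inverse_acn_A_Suc [of t], of "\<lambda>c. F u * c"]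
    by (simp add: \<kappa>_def algebra_simps)
  ultimately show ?case
    using Suc unfolding acn_psi.simps(3) \<kappa>_def [symmetric]
    by (simp add: algebra_simps)
qed simp

lemma acn_estimate:
  assumes convex: "convex_on UNIV F"
    and \<beta>: "0 < \<beta>"
    and similar: "\<And>z. norm (H z - H\<^sub>1 z) \<le> \<beta>"
    and w: "\<And>t. t \<ge> 1 \<Longrightarrow>
      w t = (1 - 3 / (real t + 3)) *\<^sub>R x t + (3 / (real t + 3)) *\<^sub>R y t"
    and step_x: "\<And>t u. t \<ge> 1 \<Longrightarrow>
      cubic_model F G H\<^sub>1 \<beta> (4 * L) (x (t + 1)) (w t) \<le> cubic_model F G H\<^sub>1 \<beta> (4 * L) u (w t)"
    and step_y: "\<And>t u. t \<ge> 1 \<Longrightarrow> acn_psi F G L \<beta> x t (y t) \<le> acn_psi F G L \<beta> x t u"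
  shows "F (x (Suc t)) / acn_A t \<le> acn_psi F G L \<beta> x (Suc t) (y (Suc t))"
proof (induction t)
  case 0
  show ?case using \<beta> L_pos by simp
next
  case (Suc t)
  \<comment> \<open>Here a is the mixing weight 3/(t + 3) of the algorithm at index
    \<open>Suc t\<close>, and \<delta> is the distance between consecutive minimizers of the
    estimating functions.\<close>
  define A a where "A = acn_A (Suc t)" and "a = 3 / (real t + 4)"
  let ?X = "x (Suc (Suc t))" and ?Y = "y (Suc (Suc t))" and ?w = "w (Suc t)"
  define \<delta> where "\<delta> = norm (?Y - y (Suc t))"
  have A: "0 < A" "A = 6 / ((real t + 2) * (real t + 3) * (real t + 4))"
    unfolding A_def by (rule acn_A_pos) (simp add: acn_A_eq add.commute del: acn_A.simps)
  have a: "0 < a" by (simp add: a_def)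
  have \<delta>: "0 \<le> \<delta>" by (simp add: \<delta>_def)
  have A_t: "1 / acn_A t = (1 - a) / A"
  proof -
    have "A = acn_A t * (1 - a)" by (simp add: A_def a_def add.commute)
    with A(1) show ?thesis by auto
  qed
  have growth: "acn_psi F G L \<beta> x (Suc t) (y (Suc t)) + (8 + 4 * real t) * \<beta> * \<delta>\<^sup>2 + 8 * L * \<delta> ^ 3
      \<le> acn_psi F G L \<beta> x (Suc t) ?Y"
  proof -
    obtain c s where "\<And>u. acn_psi F G L \<beta> x (Suc t) u
       = c + s \<bullet> u + (8 + 4 * real t) * \<beta> * norm (u - x 0) ^ 2 + 16 * L * norm (u - x 0) ^ 3"
      using acn_psi_form by blast
    from minimizer_growth_quadratic_cubic [OF this _ step_y] L_pos show ?thesis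
      by (simp add: \<delta>_def)
  qed
  have "norm (G ?X + (3 * \<beta> + 2 * L * norm (?X - ?w)) *\<^sub>R (?X - ?w))
    \<le> (\<beta> + L / 2 * norm (?X - ?w)) * norm (?X - ?w)"
    using step_x [of "Suc t"] by (intro cubic_model_minimizer_gradient [OF similar]) simp
  from cubic_step_inequality [OF L_pos \<beta> _ this, of "a * \<delta>"]
  have descent: "norm (G ?X) * (a * \<delta>)
      \<le> - (G ?X \<bullet> (?X - ?w)) + 16 / 9 * L * (a * \<delta>) ^ 3 + 8 / 3 * \<beta> * (a * \<delta>)\<^sup>2"
    using a \<delta> by simp
  have "F (x (Suc t)) / acn_A t = (1 - a) / A * F (x (Suc t))"
    using arg_cong [OF A_t, of "\<lambda>c. c * F (x (Suc t))"] by simp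
  moreover have "(1 - a) / A * (F ?X + G ?X \<bullet> (x (Suc t) - ?X)) \<le> (1 - a) / A * F (x (Suc t))"
    using A(1) by (intro mult_left_mono convex_on_gradient_inequality [OF convex F_deriv])
      (auto simp: a_def)
  ultimately have convexity:
    "(1 - a) / A * (F ?X + G ?X \<bullet> (x (Suc t) - ?X)) \<le> F (x (Suc t)) / acn_A t" by linarith
  \<comment> \<open>The weights sum to 1/A, and (1 - a) x + a Y equals w + a (Y - y). Hence the
    linear error has size |G| a \<delta>, which explains the choice rho = a \<delta> above.\<close>
  have combine: "(1 - a) / A * (F ?X + G ?X \<bullet> (x (Suc t) - ?X)) + a / A * (F ?X + G ?X \<bullet> (?Y - ?X))
      = F ?X / A + (- (G ?X \<bullet> (?X - ?w)) + a * (G ?X \<bullet> (?Y - y (Suc t)))) / A"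
  proof -
    have w': "?w = (1 - a) *\<^sub>R x (Suc t) + a *\<^sub>R y (Suc t)"
      using w [of "Suc t"] by (simp add: a_def add.commute)
    show ?thesis
      unfolding w' using A(1) by (simp add: field_simps inner_add_right inner_diff_right)
  qed
  have "- (16 / 9 * L * (a * \<delta>) ^ 3 + 8 / 3 * \<beta> * (a * \<delta>)\<^sup>2)
      \<le> - (G ?X \<bullet> (?X - ?w)) + a * (G ?X \<bullet> (?Y - y (Suc t)))"
  proof -
    have "\<bar>G ?X \<bullet> (?Y - y (Suc t))\<bar> \<le> norm (G ?X) * \<delta>"
      unfolding \<delta>_def by (rule Cauchy_Schwarz_ineq2)
    then have "a * - (norm (G ?X) * \<delta>) \<le> a * (G ?X \<bullet> (?Y - y (Suc t)))"
      using a by (intro mult_left_mono) auto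
    with descent show ?thesis by (simp add: algebra_simps)
  qed
  moreover have "16 / 9 * L * (a * \<delta>) ^ 3 + 8 / 3 * \<beta> * (a * \<delta>)\<^sup>2
      \<le> A * ((8 + 4 * real t) * \<beta> * \<delta>\<^sup>2 + 8 * L * \<delta> ^ 3)"
  proof -
    \<comment> \<open>The left side is 48/(t + 4)^3 and the right side 48/((t + 2)(t + 3)(t + 4)).
      The quadratic comparison below is 24/(t + 4)^2 against 24/((t + 3)(t + 4)).\<close>
    have "16 / 9 * a ^ 3 \<le> 8 * A"
      unfolding A(2) a_def by (simp add: divide_simps power3_eq_cube) (simp add: algebra_simps)
    then have "16 / 9 * a ^ 3 * (L * \<delta> ^ 3) \<le> 8 * A * (L * \<delta> ^ 3)"
      using L_pos \<delta> by (intro mult_right_mono) auto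
    moreover have "8 / 3 * a\<^sup>2 \<le> (8 + 4 * real t) * A"
      unfolding A(2) a_def by (simp add: divide_simps power2_eq_square) (simp add: algebra_simps)
    then have "8 / 3 * a\<^sup>2 * (\<beta> * \<delta>\<^sup>2) \<le> (8 + 4 * real t) * A * (\<beta> * \<delta>\<^sup>2)"
      using \<beta> by (intro mult_right_mono) auto
    ultimately show ?thesis by (simp add: power_mult_distrib algebra_simps)
  qed
  ultimately have "- (A * ((8 + 4 * real t) * \<beta> * \<delta>\<^sup>2 + 8 * L * \<delta> ^ 3))
      \<le> - (G ?X \<bullet> (?X - ?w)) + a * (G ?X \<bullet> (?Y - y (Suc t)))" by linarith
  then have "- ((8 + 4 * real t) * \<beta> * \<delta>\<^sup>2 + 8 * L * \<delta> ^ 3)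
      \<le> (- (G ?X \<bullet> (?X - ?w)) + a * (G ?X \<bullet> (?Y - y (Suc t)))) / A"
    unfolding pos_le_divide_eq [OF A(1)] by (simp only: minus_mult_left [symmetric] mult.commute [of _ A])
  moreover have "acn_psi F G L \<beta> x (Suc (Suc t)) ?Y = acn_psi F G L \<beta> x (Suc t) ?Y
      + 4 * \<beta> * norm (?Y - x 0) ^ 2 + a / A * (F ?X + G ?X \<bullet> (?Y - ?X))"
    by (simp add: A_def a_def add.commute mult.commute)
  \<comment> \<open>The regularization added in this round is discarded here; it strengthens the
    growth used in later rounds through the coefficient 8 + 4t.\<close>
  moreover have "0 \<le> 4 * \<beta> * norm (?Y - x 0) ^ 2" using \<beta> by simp
  ultimately have "F ?X / A \<le> acn_psi F G L \<beta> x (Suc (Suc t)) ?Y"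
    using growth convexity combine Suc.IH by linarith
  then show ?case by (simp add: A_def)
qed

end

section \<open>Rate constants and the convergence theorem\<close>

text \<open>P and Q stand for beta r^2 and L r^3. The iterate has index t + 1, so the product (t +
  1)(t + 2)(t + 3) in A is compared with powers of t + 1.\<close>

lemma acn_rate_constants:
  fixes P Q :: real
  assumes "0 \<le> P" "0 \<le> Q"
  shows "acn_A t * ((9 + 4 * real t) * P + 49 / 3 * Q)
    \<le> 98 * Q / real (Suc t) ^ 3 + 48 * P / real (Suc t) ^ 2"
proof -
  have "acn_A t * (49 / 3) \<le> 98 / real (Suc t) ^ 3"
    unfolding acn_A_eq by (simp add: divide_simps power3_eq_cube) (simp add: algebra_simps)
  moreover have "acn_A t * (9 + 4 * real t) \<le> 48 / real (Suc t) ^ 2"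
    unfolding acn_A_eq by (simp add: divide_simps power2_eq_square) (simp add: algebra_simps)
  ultimately have "acn_A t * (49 / 3) * Q + acn_A t * (9 + 4 * real t) * P
      \<le> 98 / real (Suc t) ^ 3 * Q + 48 / real (Suc t) ^ 2 * P"
    using assms by (intro add_mono mult_right_mono) auto
  then show ?thesis by (simp add: algebra_simps)
qed

theorem theorem1:
  fixes m :: nat
    and f :: "nat \<Rightarrow> 'a::euclidean_space \<Rightarrow> real"
    and g :: "nat \<Rightarrow> 'a \<Rightarrow> 'a"
    and H :: "nat \<Rightarrow> 'a \<Rightarrow> ('a \<Rightarrow>\<^sub>L 'a)"
    and L \<beta> :: real
    and xstar :: 'a
    and x y w :: "nat \<Rightarrow> 'a"
  assumes m: "m \<ge> 1"
    and grad: "\<And>k z. k \<in> {1..m} \<Longrightarrow> (f k has_derivative (\<lambda>v. g k z \<bullet> v)) (at z)"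
    and hess: "\<And>k z. k \<in> {1..m} \<Longrightarrow> (g k has_derivative blinfun_apply (H k z)) (at z)"
    and hess_cont: "\<And>k. k \<in> {1..m} \<Longrightarrow> continuous_on UNIV (H k)"
    and convex: "convex_on UNIV (avgF m f)"
    and minimizer: "\<And>z. avgF m f xstar \<le> avgF m f z"
    and L_pos: "L > 0"
    and lipschitz: "\<And>u v. norm (avgH m H u - avgH m H v) \<le> L * norm (u - v)"
    and beta_pos: "\<beta> > 0"
    and similarity: "\<And>k z. k \<in> {1..m} \<Longrightarrow> norm (avgH m H z - H k z) \<le> \<beta>"
    and step0: "\<And>u. cubic_model (avgF m f) (avgG m g) (H 1) \<beta> (4 * L) (x 1) (x 0)
                     \<le> cubic_model (avgF m f) (avgG m g) (H 1) \<beta> (4 * L) u (x 0)"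
    and w_def: "\<And>t. t \<ge> 1 \<Longrightarrow>
                 w t = (1 - 3 / (real t + 3)) *\<^sub>R x t + (3 / (real t + 3)) *\<^sub>R y t"
    and step_x: "\<And>t u. t \<ge> 1 \<Longrightarrow>
                 cubic_model (avgF m f) (avgG m g) (H 1) \<beta> (4 * L) (x (t + 1)) (w t)
                 \<le> cubic_model (avgF m f) (avgG m g) (H 1) \<beta> (4 * L) u (w t)"
    and step_y: "\<And>t u. t \<ge> 1 \<Longrightarrow>
                 acn_psi (avgF m f) (avgG m g) L \<beta> x t (y t)
                 \<le> acn_psi (avgF m f) (avgG m g) L \<beta> x t u"
  shows "\<forall>t\<ge>1. avgF m f (x t) - avgF m f xstar
           \<le> 98 * L * norm (x 0 - xstar) ^ 3 / real t ^ 3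
             + 48 * \<beta> * norm (x 0 - xstar) ^ 2 / real t ^ 2"
proof -
  let ?F = "avgF m f" and ?G = "avgG m g" and ?H = "avgH m H"
  interpret lipschitz_hessian ?F ?G ?H L
  proof
    show "(?F has_derivative (\<lambda>v. ?G z \<bullet> v)) (at z)" for z
      unfolding avgF_def [abs_def] avgG_def
      by (rule has_derivative_eq_rhs, rule has_derivative_mult_right, rule has_derivative_sum,
          erule grad) (simp add: inner_sum_left)
    show "(?G has_derivative blinfun_apply (?H z)) (at z)" for z
      unfolding avgG_def [abs_def] avgH_def
      by (rule has_derivative_eq_rhs, rule has_derivative_scaleR_right, rule has_derivative_sum,
          erule hess) (simp add: fun_eq_iff blinfun.scaleR_left blinfun.sum_left)
  qed (use lipschitz L_pos in auto)
  have similar: "norm (?H z - H 1 z) \<le> \<beta>" for z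
    using similarity [of 1 z] m by simp
  have crit: "?G xstar = 0"
  proof -
    have "(\<lambda>v. ?G xstar \<bullet> v) = (\<lambda>v. 0)"
      using F_deriv by (rule has_derivative_local_min) (simp add: minimizer)
    then show ?thesis by (metis inner_eq_zero_iff)
  qed
  define r where "r = norm (x 0 - xstar)"
  have r: "0 \<le> r" by (simp add: r_def)
  have first: "?F (x 1) - ?F xstar \<le> \<beta> * r\<^sup>2 + L / 3 * r ^ 3"
    unfolding r_def
    by (intro cubic_step_gap_from_stationary_point beta_pos crit
        cubic_model_minimizer_gradient [OF similar] step0)
  have "?F (x (Suc t)) - ?F xstar \<le> 98 * L * r ^ 3 / real (Suc t) ^ 3 + 48 * \<beta> * r ^ 2 / real (Suc t) ^ 2"
    for t
  proof -
    have "?F (x (Suc t)) / acn_A t \<le> acn_psi ?F ?G L \<beta> x (Suc t) (y (Suc t))"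
      by (rule acn_estimate [OF convex beta_pos similar w_def step_x step_y])
    also have "\<dots> \<le> acn_psi ?F ?G L \<beta> x (Suc t) xstar"
      by (rule step_y) simp
    also have "\<dots> \<le> ?F xstar / acn_A t + (?F (x 1) - ?F xstar)
        + (8 + 4 * real t) * \<beta> * r ^ 2 + 16 * L * r ^ 3"
      using acn_psi_upper_bound [OF convex, of \<beta> x t xstar]
      by (simp add: r_def norm_minus_commute)
    \<comment> \<open>The gap at \<open>x 1\<close> raises 8 + 4t to 9 + 4t and 16 to 49/3.\<close>
    finally have "(?F (x (Suc t)) - ?F xstar) / acn_A t
        \<le> (9 + 4 * real t) * (\<beta> * r\<^sup>2) + 49 / 3 * (L * r ^ 3)"
      using first by (simp add: diff_divide_distrib algebra_simps)
    then have "?F (x (Suc t)) - ?F xstar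
        \<le> acn_A t * ((9 + 4 * real t) * (\<beta> * r\<^sup>2) + 49 / 3 * (L * r ^ 3))"
      using acn_A_pos [of t] by (simp add: pos_divide_le_eq mult.commute)
    also have "\<dots> \<le> 98 * (L * r ^ 3) / real (Suc t) ^ 3 + 48 * (\<beta> * r\<^sup>2) / real (Suc t) ^ 2"
      using beta_pos L_pos r by (intro acn_rate_constants) auto
    finally show ?thesis by (simp add: mult.assoc)
  qed
  then have "?F (x t) - ?F xstar \<le> 98 * L * r ^ 3 / real t ^ 3 + 48 * \<beta> * r ^ 2 / real t ^ 2"
    if "1 \<le> t" for t
    using that by (cases t) auto
  then show ?thesis by (simp add: r_def)
qed

end
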